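(* Let $p$ be a prime and let $G$ be a solvable group whose center is $C(G)\cong\bigoplus_{i=1}^{\infty}\mathbb{Z}/p^i\mathbb{Z}$ and such that $G/C(G)\cong\mathbb{Z}\wr\mathbb{Z}$. Then $G$ is bounded, but $C(G)$ is not bounded.
   Context: $\mathbb{Z}\wr\mathbb{Z}$ denotes the restricted wreath product $\left(\bigoplus_{i\in\mathbb{Z}}\mathbb{Z}\right)\rtimes\mathbb{Z}$ with $\mathbb{Z}$ acting by shifting coordinates. Let $w=w(x_1,\dots,x_n)$ be a word (element of the free group $F_n$ on $x_1,\dots,x_n$, $n\ge 1$). Its Engel type iterations on the first variable are $w_{\circ 1}=w$ and $w_{\circ (N+1)}(x_1,\dots,x_n)=w(w_{\circ N}(x_1,\dots,x_n),x_2,\dots,x_n)$ for $N\ge 1$. A group $G$ satisfies the ($E$-type) iterated identity $w$ if for all $x_1,\dots,x_n\in G$ there exists $N\ge 1$ with $w_{\circ N}(x_1,\dots,x_n)=e$ in $G$. If $w$ is an iterated identity of $G$, the iterational depth $s(w,G)$ of $w$ in $G$ is the infimum (possibly $+\infty$) of those integers $D\ge 1$ such that for all $x_1,\dots,x_n\in G$ there is $1\le d\le D$ with $w_{\circ d}(x_1,\dots,x_n)=e$. A word is non-trivial if it is not equal to the identity in the free group. The iterational depth of $G$ is $s(G)=\sup_w s(w,G)$, the supremum over all non-trivial iterated identities $w$ (in any number of variables) satisfied by $G$; if $G$ satisfies no non-trivial iterated identity, $s(G)=-\infty$. $G$ is called bounded if $1\le s(G)<\infty$. *)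

theory Defs
  imports "HOL-Analysis.Analysis" "HOL-Algebra.Algebra"
begin

section \<open>Free groups\<close>

text \<open>The letter (i, True) is the generator with index i, and (i, False) is its inverse. The free
  group is realised on the freely reduced words, so that distinct lists are distinct elements.\<close>

type_synonym 'x word = "('x \<times> bool) list"

definition letter_inv :: "'x \<times> bool \<Rightarrow> 'x \<times> bool" where
  "letter_inv a = (fst a, \<not> snd a)"

definition reduced :: "'x word \<Rightarrow> bool" where
  "reduced w \<longleftrightarrow> successively (\<lambda>a b. b \<noteq> letter_inv a) w"

fun cons_reduce :: "'x \<times> bool \<Rightarrow> 'x word \<Rightarrow> 'x word" where
  "cons_reduce a [] = [a]"
| "cons_reduce a (b # w) = (if b = letter_inv a then w else a # b # w)"

definition free_group :: "'x set \<Rightarrow> 'x word monoid" where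
  "free_group I = \<lparr>carrier = {w. fst ` set w \<subseteq> I \<and> reduced w},
                   monoid.mult = (\<lambda>u v. foldr cons_reduce u v), one = []\<rparr>"

definition free_gen :: "'x \<Rightarrow> 'x word" where
  "free_gen i = [(i, True)]"

definition word_eval :: "('a, 'b) monoid_scheme \<Rightarrow> ('x \<Rightarrow> 'a) \<Rightarrow> 'x word \<Rightarrow> 'a" where
  "word_eval G x w =
     foldr (\<lambda>(i, b) g. (if b then x i else inv\<^bsub>G\<^esub> (x i)) \<otimes>\<^bsub>G\<^esub> g) w \<one>\<^bsub>G\<^esub>"

lemma letter_inv_inv [simp]: "letter_inv (letter_inv a) = a"
  by (simp add: letter_inv_def)

lemma fst_letter_inv [simp]: "fst (letter_inv a) = fst a"
  by (simp add: letter_inv_def)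

lemma letter_inv_neq [simp]: "letter_inv a \<noteq> a" "a \<noteq> letter_inv a"
  by (auto simp: letter_inv_def prod_eq_iff)

lemma reduced_Nil [simp]: "reduced []"
  by (simp add: reduced_def)

lemma reduced_Cons:
  "reduced (a # w) \<longleftrightarrow> reduced w \<and> (w = [] \<or> hd w \<noteq> letter_inv a)"
  by (cases w) (auto simp: reduced_def)

lemma reduced_cons_reduce: "reduced w \<Longrightarrow> reduced (cons_reduce a w)"
  by (cases w) (auto simp: reduced_Cons)

lemma set_cons_reduce: "set (cons_reduce a w) \<subseteq> insert a (set w)"
  by (cases w) auto

lemma cons_reduce_letter_inv:
  "reduced w \<Longrightarrow> cons_reduce (letter_inv a) (cons_reduce a w) = w"
  "reduced w \<Longrightarrow> cons_reduce a (cons_reduce (letter_inv a) w) = w"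
  by (cases w; cases "tl w"; auto simp: reduced_Cons)+

lemma cons_reduce_reduced: "reduced (a # w) \<Longrightarrow> cons_reduce a w = a # w"
  by (cases w) (auto simp: reduced_Cons)

lemma reduced_mult: "reduced v \<Longrightarrow> reduced (foldr cons_reduce u v)"
  by (induction u) (auto intro: reduced_cons_reduce)

lemma set_mult: "set (foldr cons_reduce u v) \<subseteq> set u \<union> set v"
  by (induction u) (use set_cons_reduce in fastforce)+

lemma mult_Nil: "reduced u \<Longrightarrow> foldr cons_reduce u [] = u"
proof (induction u)
  case (Cons a u)
  then have "foldr cons_reduce u [] = u" by (simp add: reduced_Cons)
  with Cons.prems show ?case by (simp add: cons_reduce_reduced)
qed simp

lemma foldr_cons_reduce:
  assumes "reduced w"
  shows "foldr cons_reduce (cons_reduce a v) w = cons_reduce a (foldr cons_reduce v w)"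
  using assms by (cases v) (auto simp: cons_reduce_letter_inv reduced_mult)

lemma mult_assoc_reduced:
  assumes "reduced w"
  shows "foldr cons_reduce (foldr cons_reduce u v) w = foldr cons_reduce u (foldr cons_reduce v w)"
  by (induction u) (auto simp: foldr_cons_reduce assms)

lemma mult_rev_letter_inv:
  "reduced v \<Longrightarrow> foldr cons_reduce (rev (map letter_inv u)) (foldr cons_reduce u v) = v"
  by (induction u arbitrary: v) (auto simp: cons_reduce_letter_inv reduced_mult)

lemma group_free_group: "group (free_group I)"
proof (rule groupI)
  fix u v
  assume "u \<in> carrier (free_group I)" "v \<in> carrier (free_group I)"
  then show "u \<otimes>\<^bsub>free_group I\<^esub> v \<in> carrier (free_group I)"
    using set_mult[of u v] by (fastforce simp: free_group_def reduced_mult)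
next
  fix u
  assume u: "u \<in> carrier (free_group I)"
  let ?v = "foldr cons_reduce (rev (map letter_inv u)) []"
  have "?v \<in> carrier (free_group I)"
    using u set_mult[of "rev (map letter_inv u)" "[]"]
    by (fastforce simp: free_group_def reduced_mult)
  moreover have "?v \<otimes>\<^bsub>free_group I\<^esub> u = \<one>\<^bsub>free_group I\<^esub>"
    using u mult_rev_letter_inv[of "[]" u]
    by (simp add: free_group_def mult_assoc_reduced mult_Nil)
  ultimately show "\<exists>v\<in>carrier (free_group I). v \<otimes>\<^bsub>free_group I\<^esub> u = \<one>\<^bsub>free_group I\<^esub>"
    by blast
qed (auto simp: free_group_def mult_assoc_reduced)

lemma (in group) word_eval_closed:
  "x \<in> fst ` set w \<rightarrow> carrier G \<Longrightarrow> word_eval G x w \<in> carrier G"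
  by (induction w) (auto simp: word_eval_def)

lemma (in group) word_eval_cons_reduce:
  assumes "x \<in> insert (fst a) (fst ` set w) \<rightarrow> carrier G"
  shows "word_eval G x (cons_reduce a w) = word_eval G x (a # w)"
proof (cases w)
  case (Cons b v)
  have "word_eval G x v \<in> carrier G"
    using assms Cons by (intro word_eval_closed) auto
  then show ?thesis
    using assms Cons
    by (cases a) (auto simp: word_eval_def letter_inv_def inv_solve_left' m_assoc[symmetric])
qed simp

lemma (in group) word_eval_hom:
  assumes "x \<in> I \<rightarrow> carrier G"
  shows "word_eval G x \<in> hom (free_group I) G"
proof (rule homI)
  fix u v
  assume u: "u \<in> carrier (free_group I)" and v: "v \<in> carrier (free_group I)"
  have v': "word_eval G x v \<in> carrier G" if "fst ` set v \<subseteq> I" for v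
    using that assms by (intro word_eval_closed) auto
  have "word_eval G x (foldr cons_reduce u v) = word_eval G x u \<otimes> word_eval G x v"
    if "fst ` set u \<subseteq> I" for u
    using that
  proof (induction u)
    case Nil
    then show ?case using v v' by (simp add: word_eval_def free_group_def)
  next
    case (Cons a u)
    have "fst ` set (foldr cons_reduce u v) \<subseteq> I"
      using Cons.prems v set_mult[of u v] by (fastforce simp: free_group_def)
    then have "word_eval G x (cons_reduce a (foldr cons_reduce u v))
               = word_eval G x (a # foldr cons_reduce u v)"
      using Cons.prems assms by (intro word_eval_cons_reduce) auto
    then show ?case
      using Cons assms v v'[of u] v'[of v]
      by (cases a) (auto simp: word_eval_def free_group_def m_assoc Pi_iff)
  qed
  with u show "word_eval G x (u \<otimes>\<^bsub>free_group I\<^esub> v) = word_eval G x u \<otimes> word_eval G x v"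
    by (simp add: free_group_def)
next
  fix u
  assume "u \<in> carrier (free_group I)"
  with assms show "word_eval G x u \<in> carrier G"
    by (intro word_eval_closed) (auto simp: free_group_def)
qed

section \<open>Iterated identities and iterational depth\<close>

text \<open>The value at 0 is never used; the substituted variable is the one with index 1.\<close>

fun engel_iter :: "nat \<Rightarrow> nat word \<Rightarrow> nat \<Rightarrow> nat word" where
  "engel_iter n w 0 = free_gen 1"
| "engel_iter n w (Suc 0) = w"
| "engel_iter n w (Suc (Suc N)) =
     word_eval (free_group {1..n}) (free_gen(1 := engel_iter n w (Suc N))) w"

definition iterated_identity :: "('a, 'b) monoid_scheme \<Rightarrow> nat \<Rightarrow> nat word \<Rightarrow> bool" where
  "iterated_identity G n w \<longleftrightarrow>
     (\<forall>x \<in> {1..n} \<rightarrow> carrier G. \<exists>N\<ge>1. word_eval G x (engel_iter n w N) = \<one>\<^bsub>G\<^esub>)"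

definition identity_depth :: "('a, 'b) monoid_scheme \<Rightarrow> nat \<Rightarrow> nat word \<Rightarrow> enat" where
  "identity_depth G n w =
     Inf {enat D | D. D \<ge> 1 \<and> (\<forall>x \<in> {1..n} \<rightarrow> carrier G.
            \<exists>d. 1 \<le> d \<and> d \<le> D \<and> word_eval G x (engel_iter n w d) = \<one>\<^bsub>G\<^esub>)}"

definition iterational_depth :: "('a, 'b) monoid_scheme \<Rightarrow> ereal" where
  "iterational_depth G =
     Sup {ereal_of_enat (identity_depth G n w) | n w.
            n \<ge> 1 \<and> w \<in> carrier (free_group {1..n}) \<and> w \<noteq> \<one>\<^bsub>free_group {1..n}\<^esub>
            \<and> iterated_identity G n w}"

definition bounded_group :: "('a, 'b) monoid_scheme \<Rightarrow> bool" where
  "bounded_group G \<longleftrightarrow> 1 \<le> iterational_depth G \<and> iterational_depth G < \<infinity>"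

lemma iterational_depth_no_identity:
  assumes "\<And>n w. \<lbrakk>n \<ge> 1; w \<in> carrier (free_group {1..n}); w \<noteq> \<one>\<^bsub>free_group {1..n}\<^esub>\<rbrakk>
             \<Longrightarrow> \<not> iterated_identity G n w"
  shows "iterational_depth G = - \<infinity>"
proof -
  have "{ereal_of_enat (identity_depth G n w) | n w.
            n \<ge> 1 \<and> w \<in> carrier (free_group {1..n}) \<and> w \<noteq> \<one>\<^bsub>free_group {1..n}\<^esub>
            \<and> iterated_identity G n w} = {}"
    using assms by blast
  then show ?thesis
    unfolding iterational_depth_def by (simp only: Sup_empty bot_ereal_def)
qed

section \<open>Center and restricted wreath product\<close>

definition center :: "('a, 'b) monoid_scheme \<Rightarrow> 'a set" where
  "center G = {z \<in> carrier G. \<forall>g \<in> carrier G. z \<otimes>\<^bsub>G\<^esub> g = g \<otimes>\<^bsub>G\<^esub> z}"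

lemma (in group) subgroup_center: "subgroup (center G) G"
proof (rule subgroupI)
  fix z assume "z \<in> center G"
  then have z: "z \<in> carrier G" "\<And>g. g \<in> carrier G \<Longrightarrow> z \<otimes> g = g \<otimes> z"
    by (auto simp: center_def)
  have "inv z \<otimes> g = g \<otimes> inv z" if g: "g \<in> carrier G" for g
  proof -
    have "inv z \<otimes> g = inv (inv g \<otimes> z)" using z(1) g by (simp add: inv_mult_group)
    also have "inv g \<otimes> z = z \<otimes> inv g" using z g by simp
    also have "inv (z \<otimes> inv g) = g \<otimes> inv z" using z(1) g by (simp add: inv_mult_group)
    finally show ?thesis .
  qed
  with z(1) show "inv z \<in> center G" unfolding center_def by blast
next
  fix y z assume "y \<in> center G" "z \<in> center G"
  then have y: "y \<in> carrier G" "\<And>g. g \<in> carrier G \<Longrightarrow> y \<otimes> g = g \<otimes> y"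
    and z: "z \<in> carrier G" "\<And>g. g \<in> carrier G \<Longrightarrow> z \<otimes> g = g \<otimes> z"
    by (auto simp: center_def)
  have "y \<otimes> z \<otimes> g = g \<otimes> (y \<otimes> z)" if g: "g \<in> carrier G" for g
  proof -
    have "y \<otimes> z \<otimes> g = y \<otimes> (z \<otimes> g)" using y(1) z(1) g by (rule m_assoc)
    also have "z \<otimes> g = g \<otimes> z" using g by (rule z(2))
    also have "y \<otimes> (g \<otimes> z) = (y \<otimes> g) \<otimes> z" using y(1) z(1) g by (simp only: m_assoc)
    also have "y \<otimes> g = g \<otimes> y" using g by (rule y(2))
    also have "g \<otimes> y \<otimes> z = g \<otimes> (y \<otimes> z)" using y(1) z(1) g by (simp only: m_assoc)
    finally show ?thesis .
  qed
  with y(1) z(1) show "y \<otimes> z \<in> center G" by (simp add: center_def)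
next
  show "center G \<noteq> {}" by (auto simp: center_def intro!: exI[of _ \<one>])
qed (auto simp: center_def)

lemma (in group) normal_center: "center G \<lhd> G"
proof (rule normal_invI[OF subgroup_center])
  fix g z assume g: "g \<in> carrier G" and "z \<in> center G"
  then have z: "z \<in> carrier G" "z \<otimes> g = g \<otimes> z"
    by (auto simp: center_def)
  have "g \<otimes> z \<otimes> inv g = z"
    using z(1) g by (simp add: z(2)[symmetric] m_assoc)
  with \<open>z \<in> center G\<close> show "g \<otimes> z \<otimes> inv g \<in> center G" by simp
qed

definition semidirect_product ::
    "('a, 'c) monoid_scheme \<Rightarrow> ('b, 'd) monoid_scheme \<Rightarrow> ('b \<Rightarrow> 'a \<Rightarrow> 'a) \<Rightarrow> ('a \<times> 'b) monoid" where
  "semidirect_product N H \<phi> =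
     \<lparr>carrier = carrier N \<times> carrier H,
      monoid.mult = (\<lambda>(a, h) (b, k). (a \<otimes>\<^bsub>N\<^esub> \<phi> h b, h \<otimes>\<^bsub>H\<^esub> k)),
      one = (\<one>\<^bsub>N\<^esub>, \<one>\<^bsub>H\<^esub>)\<rparr>"

definition shift :: "int \<Rightarrow> (int \<Rightarrow> 'a) \<Rightarrow> int \<Rightarrow> 'a" where
  "shift k f = (\<lambda>i. f (i - k))"

definition wreath_Z_Z :: "((int \<Rightarrow> int) \<times> int) monoid" where
  "wreath_Z_Z = semidirect_product (sum_group UNIV (\<lambda>_. integer_group)) integer_group shift"

lemma carrier_sum_group_Z:
  "carrier (sum_group UNIV (\<lambda>_::int. integer_group)) = {f. finite {i. f i \<noteq> 0}}"
proof -
  have "carrier integer_group = UNIV" "\<one>\<^bsub>integer_group\<^esub> = 0"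
    by (simp_all add: integer_group_def)
  then show ?thesis
    by (subst carrier_sum_group) simp_all
qed

lemma mult_sum_group_Z:
  "f \<otimes>\<^bsub>sum_group UNIV (\<lambda>_::int. integer_group)\<^esub> g = (\<lambda>i. f i + g i)"
  by (simp add: sum_group_def product_group_def integer_group_def restrict_def)

lemma one_sum_group_Z: "\<one>\<^bsub>sum_group UNIV (\<lambda>_::int. integer_group)\<^esub> = (\<lambda>i. 0)"
  by (simp add: sum_group_def product_group_def integer_group_def restrict_def)

lemma group_wreath_Z_Z: "group wreath_Z_Z"
proof -
  have fin_shift: "finite {i. shift k f i \<noteq> 0}" if "finite {i. f i \<noteq> 0}"
    for k and f :: "int \<Rightarrow> int"
  proof -
    have "{i. shift k f i \<noteq> 0} \<subseteq> (\<lambda>i. i + k) ` {i. f i \<noteq> 0}"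
    proof
      fix i assume "i \<in> {i. shift k f i \<noteq> 0}"
      then have "i = (i - k) + k" "i - k \<in> {i. f i \<noteq> 0}" by (simp_all add: shift_def)
      then show "i \<in> (\<lambda>i. i + k) ` {i. f i \<noteq> 0}" by (rule image_eqI)
    qed
    with that show ?thesis by (rule finite_surj)
  qed
  have fin_add: "finite {i. f i + g i \<noteq> 0}"
    if "finite {i. f i \<noteq> 0}" "finite {i. g i \<noteq> 0}" for f g :: "int \<Rightarrow> int"
    by (rule finite_subset[OF _ finite_UnI[OF that]]) auto
  have carrier: "carrier wreath_Z_Z = {f. finite {i. f i \<noteq> 0}} \<times> UNIV"
    by (simp add: wreath_Z_Z_def semidirect_product_def carrier_sum_group_Z)
  have mult: "(f, h) \<otimes>\<^bsub>wreath_Z_Z\<^esub> (g, k) = (\<lambda>i. f i + shift h g i, h + k)" for f g h k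
    by (simp add: wreath_Z_Z_def semidirect_product_def restrict_def)
  have one: "\<one>\<^bsub>wreath_Z_Z\<^esub> = (\<lambda>i. 0, 0)"
    by (simp add: wreath_Z_Z_def semidirect_product_def one_sum_group_Z del: one_sum_group)
  show ?thesis
  proof (rule groupI)
    fix x y assume "x \<in> carrier wreath_Z_Z" "y \<in> carrier wreath_Z_Z"
    then show "x \<otimes>\<^bsub>wreath_Z_Z\<^esub> y \<in> carrier wreath_Z_Z"
      by (cases x; cases y) (auto simp: carrier mult intro!: fin_add fin_shift)
  next
    fix x assume x: "x \<in> carrier wreath_Z_Z"
    obtain f h where [simp]: "x = (f, h)" by fastforce
    have "(\<lambda>i. - shift (- h) f i, - h) \<in> carrier wreath_Z_Z"
      using x fin_shift[of f "- h"] by (simp add: carrier)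
    moreover have "(\<lambda>i. - shift (- h) f i, - h) \<otimes>\<^bsub>wreath_Z_Z\<^esub> x = \<one>\<^bsub>wreath_Z_Z\<^esub>"
      by (simp add: mult one)
    ultimately show "\<exists>y\<in>carrier wreath_Z_Z. y \<otimes>\<^bsub>wreath_Z_Z\<^esub> x = \<one>\<^bsub>wreath_Z_Z\<^esub>" by blast
  qed (auto simp: carrier mult one shift_def fun_eq_iff algebra_simps)
qed

end

theory Submission
  imports Defs
begin

text \<open>Fix the values of all variables but the first and let T be the map sending the first variable to
  the value of the word. On the integers T is affine, and on the base group of the wreath product,
  which is the additive group of the Laurent polynomials, T is affine with a Laurent polynomial as
  slope. If all orbits of an affine map over an infinite domain pass through 0, the map is zero.
  Hence all exponent sums vanish, so that T maps the wreath product to its base, and T maps the base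
  to 1. In G it follows that T T g is central; since the exponent sum of the first variable is 0,
  T is constant on the center, with value T 1 = 1, and every orbit reaches 1 in three steps. In the
  center the power with exponent p is an iterated identity of infinite depth.\<close>

section \<open>Evaluating words\<close>

lemma word_eval_Nil [simp]: "word_eval G x [] = \<one>\<^bsub>G\<^esub>"
  by (simp add: word_eval_def)

lemma word_eval_Cons [simp]:
  "word_eval G x (a # w) =
     (if snd a then x (fst a) else inv\<^bsub>G\<^esub> x (fst a)) \<otimes>\<^bsub>G\<^esub> word_eval G x w"
  by (cases a) (simp add: word_eval_def)

lemma word_eval_cong:
  "(\<And>i. i \<in> fst ` set w \<Longrightarrow> x i = y i) \<Longrightarrow> word_eval G x w = word_eval G y w"
  by (induction w) auto

lemma (in group_hom) hom_word_eval:
  "x \<in> fst ` set w \<rightarrow> carrier G \<Longrightarrow> h (word_eval G x w) = word_eval H (h \<circ> x) w"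
proof (induction w)
  case (Cons a w)
  then have "x (fst a) \<in> carrier G" "word_eval G x w \<in> carrier G"
    by (auto intro!: G.word_eval_closed)
  with Cons show ?case by auto
qed simp

lemma (in group) word_eval_append:
  "x \<in> fst ` set (u @ v) \<rightarrow> carrier G \<Longrightarrow>
     word_eval G x (u @ v) = word_eval G x u \<otimes> word_eval G x v"
proof (induction u)
  case Nil
  then show ?case by (simp add: word_eval_closed)
next
  case (Cons a u)
  then have "x (fst a) \<in> carrier G" "word_eval G x u \<in> carrier G" "word_eval G x v \<in> carrier G"
    by (auto intro!: word_eval_closed)
  with Cons show ?case by (auto simp: m_assoc)
qed

definition word_inv :: "'x word \<Rightarrow> 'x word" where
  "word_inv w = rev (map letter_inv w)"

text \<open>Plain concatenation without cancellation: the list is an element of the free group only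
  if it happens to be reduced, which has to be checked for concrete words.\<close>

definition word_commutator :: "'x word \<Rightarrow> 'x word \<Rightarrow> 'x word" where
  "word_commutator u v = u @ v @ word_inv u @ word_inv v"

lemma fst_set_word_inv [simp]: "fst ` set (word_inv w) = fst ` set w"
  by (simp add: word_inv_def image_image)

lemma (in group) word_eval_inv:
  "x \<in> fst ` set w \<rightarrow> carrier G \<Longrightarrow> word_eval G x (word_inv w) = inv (word_eval G x w)"
proof (induction w)
  case (Cons a w)
  then have "x (fst a) \<in> carrier G" "word_eval G x w \<in> carrier G"
    by (auto intro!: word_eval_closed)
  moreover have "word_eval G x (word_inv (a # w)) =
      word_eval G x (word_inv w) \<otimes> word_eval G x [letter_inv a]"
    using Cons.prems fst_set_word_inv[of w]
    by (subst word_eval_append[symmetric]) (auto simp: word_inv_def)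
  ultimately show ?case
    using Cons by (auto simp: letter_inv_def inv_mult_group)
qed (simp add: word_inv_def)

lemma (in group) word_eval_commutator:
  assumes "x \<in> fst ` set u \<union> fst ` set v \<rightarrow> carrier G"
    and comm: "word_eval G x u \<otimes> word_eval G x v = word_eval G x v \<otimes> word_eval G x u"
  shows "word_eval G x (word_commutator u v) = \<one>"
proof -
  have u: "x \<in> fst ` set u \<rightarrow> carrier G" and v: "x \<in> fst ` set v \<rightarrow> carrier G"
    using assms(1) by auto
  have c: "word_eval G x u \<in> carrier G" "word_eval G x v \<in> carrier G"
    using u v by (auto intro!: word_eval_closed)
  have "x \<in> fst ` set (u @ v @ word_inv u @ word_inv v) \<rightarrow> carrier G"
    using assms(1) by (simp add: image_Un Un_ac)
  then have "word_eval G x (word_commutator u v) =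
      word_eval G x u \<otimes> (word_eval G x v \<otimes> (inv (word_eval G x u) \<otimes> inv (word_eval G x v)))"
    using assms(1) u v unfolding word_commutator_def
    by (simp add: word_eval_append word_eval_inv image_Un)
  also have "\<dots> = (word_eval G x u \<otimes> word_eval G x v) \<otimes> inv (word_eval G x v \<otimes> word_eval G x u)"
    using c by (simp add: m_assoc inv_mult_group)
  also have "\<dots> = \<one>" using c comm by simp
  finally show ?thesis .
qed

definition exponent_sum :: "'x \<Rightarrow> 'x word \<Rightarrow> int" where
  "exponent_sum i w = (\<Sum>a\<leftarrow>w. if fst a = i then (if snd a then 1 else - 1) else 0)"

text \<open>Every occurrence of the central \<open>z\<close> moves to the front past the other
  letters, and what stays behind is the word with variable \<open>i\<close> set to 1. This makes
  words affine on the integers, and constant on a center when the exponent sum is 0.\<close>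

lemma (in group) word_eval_central:
  assumes z: "z \<in> center G" and "x \<in> fst ` set w \<rightarrow> carrier G"
  shows "word_eval G (x(i := z)) w = z [^] exponent_sum i w \<otimes> word_eval G (x(i := \<one>)) w"
  using assms(2)
proof (induction w)
  case Nil
  then show ?case by (simp add: exponent_sum_def)
next
  case (Cons a w)
  have zc: "z \<in> carrier G" using z by (simp add: center_def)
  \<comment> \<open>Powers of \<open>z\<close> formed in the subgroup \<open>center G\<close> agree
    with those in \<open>G\<close>, so they are central as well.\<close>
  have pow: "z [^] k \<in> center G" for k :: int
    using int_pow_consistent[OF subgroup_center z]
      group.int_pow_closed[OF subgroup_imp_group[OF subgroup_center], of z k] z
    by simp
  have comm: "z [^] k \<otimes> g = g \<otimes> z [^] k" if "g \<in> carrier G" for k :: int and g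
    using pow[of k] that unfolding center_def by blast
  define v where "v = word_eval G (x(i := \<one>)) w"
  have v: "v \<in> carrier G"
    using Cons.prems unfolding v_def by (intro word_eval_closed) (fastforce simp: Pi_iff)
  define e where "e = exponent_sum i w"
  have IH: "word_eval G (x(i := z)) w = z [^] e \<otimes> v"
  proof -
    have "x \<in> fst ` set w \<rightarrow> carrier G" using Cons.prems by auto
    then show ?thesis using Cons.IH by (simp only: v_def e_def)
  qed
  have zz: "z [^] (1 + e) = z \<otimes> z [^] e" "z [^] (e - 1) = inv z \<otimes> z [^] e"
    using zc int_pow_mult[of z 1 e] int_pow_mult[of z "-1" e]
    by (simp_all add: int_pow_neg)
  have ze: "z [^] e \<in> carrier G" using zc by simp
  show ?case
  proof (cases "fst a = i")
    case True
    then have "word_eval G (x(i := z)) (a # w) =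
        (if snd a then z else inv z) \<otimes> z [^] e \<otimes> v"
      using zc ze v IH by (simp add: m_assoc)
    moreover have "exponent_sum i (a # w) = (if snd a then 1 + e else e - 1)"
      using True by (simp add: exponent_sum_def e_def)
    moreover have "word_eval G (x(i := \<one>)) (a # w) = v"
      unfolding word_eval_Cons v_def[symmetric] using True v by simp
    ultimately show ?thesis
      using zz by (cases "snd a") (simp_all only: if_True if_False)
  next
    case False
    define y where "y = (if snd a then x (fst a) else inv x (fst a))"
    have y: "y \<in> carrier G" using Cons.prems by (auto simp: y_def)
    have "word_eval G (x(i := z)) (a # w) = y \<otimes> (z [^] e \<otimes> v)"
      using False IH by (simp add: y_def)
    also have "\<dots> = z [^] e \<otimes> (y \<otimes> v)"
      using comm[OF y, of e] y ze v by (simp add: m_assoc[symmetric])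
    also have "y \<otimes> v = word_eval G (x(i := \<one>)) (a # w)"
      unfolding word_eval_Cons v_def[symmetric] using False by (simp add: y_def)
    also have "e = exponent_sum i (a # w)"
      using False by (simp add: exponent_sum_def e_def)
    finally show ?thesis .
  qed
qed

section \<open>Engel type iterations\<close>

text \<open>Evaluation is a homomorphism on the free group, so substituting for the first variable
  and then evaluating amounts to one more application of the map. This replaces iterated words by
  orbits of a self-map of \<open>G\<close>. The case \<open>N = 0\<close> fits because
  \<open>free_gen 1\<close> evaluates to \<open>x 1\<close>.\<close>

lemma word_eval_engel_iter:
  assumes "group G" "n \<ge> 1" "w \<in> carrier (free_group {1..n})" "x \<in> {1..n} \<rightarrow> carrier G"
  shows "word_eval G x (engel_iter n w N) = ((\<lambda>g. word_eval G (x(1 := g)) w) ^^ N) (x 1)"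
proof -
  interpret group G by fact
  interpret F: group "free_group {1..n}" by (rule group_free_group)
  interpret h: group_hom "free_group {1..n}" G "word_eval G x"
    by unfold_locales (rule word_eval_hom[OF assms(4)])
  have w: "fst ` set w \<subseteq> {1..n}" using assms(3) by (simp add: free_group_def)
  have gen: "free_gen i \<in> carrier (free_group {1..n})" if "i \<in> {1..n}" for i
    using that by (simp add: free_group_def free_gen_def reduced_def)
  have x: "x i \<in> carrier G" if "i \<in> {1..n}" for i using that assms(4) by auto
  \<comment> \<open>Membership in the free group is carried along, since
    \<open>hom_word_eval\<close> needs it for the substituted word.\<close>
  have "engel_iter n w N \<in> carrier (free_group {1..n}) \<and>
      word_eval G x (engel_iter n w N) = ((\<lambda>g. word_eval G (x(1 := g)) w) ^^ N) (x 1)"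
  proof (induction N)
    case 0
    then show ?case using gen[of 1] x[of 1] assms(2) by (simp add: free_gen_def)
  next
    case (Suc N)
    note IH = Suc.IH
    show ?case
    proof (cases N)
      case 0
      then show ?thesis
        using assms(3) by (simp only: engel_iter.simps funpow.simps comp_apply id_apply fun_upd_triv simp_thms)
    next
      case (Suc M)
      note IH = IH[unfolded Suc]
      let ?s = "free_gen(1 := engel_iter n w (Suc M))"
      have s: "?s \<in> fst ` set w \<rightarrow> carrier (free_group {1..n})"
        using w gen IH by auto
      have "word_eval G x (word_eval (free_group {1..n}) ?s w) = word_eval G (word_eval G x \<circ> ?s) w"
        using s by (rule h.hom_word_eval)
      also have "\<dots> = word_eval G (x(1 := word_eval G x (engel_iter n w (Suc M)))) w"
        using w x by (intro word_eval_cong) (auto simp: free_gen_def)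
      finally show ?thesis
        using F.word_eval_closed[OF s] IH by (simp only: Suc engel_iter.simps funpow.simps comp_apply)
    qed
  qed
  then show ?thesis ..
qed

text \<open>A tuple in \<open>H\<close> lifts to \<open>G\<close>, and \<open>h\<close> maps the
  orbit over the lift onto the orbit below step by step, so reaching 1 is inherited with the same
  \<open>N\<close>. The set \<open>S\<close> holds the admissible numbers of steps.\<close>

lemma engel_iter_vanishing_epi:
  assumes "group G" "group H" "h \<in> epi G H" "n \<ge> 1" "w \<in> carrier (free_group {1..n})"
    and van: "\<forall>x \<in> {1..n} \<rightarrow> carrier G. \<exists>N\<in>S. word_eval G x (engel_iter n w N) = \<one>\<^bsub>G\<^esub>"
  shows "\<forall>y \<in> {1..n} \<rightarrow> carrier H. \<exists>N\<in>S. word_eval H y (engel_iter n w N) = \<one>\<^bsub>H\<^esub>"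
proof
  fix y assume y: "y \<in> {1..n} \<rightarrow> carrier H"
  have hom: "h \<in> hom G H" and im: "h ` carrier G = carrier H"
    using assms(3) by (auto simp: epi_def)
  interpret group_hom G H h
    by (intro group_hom.intro group_hom_axioms.intro assms hom)
  define x where "x = inv_into (carrier G) h \<circ> y"
  have x: "x i \<in> carrier G" "h (x i) = y i" if "i \<in> {1..n}" for i
  proof -
    have "y i \<in> h ` carrier G" using that y im by auto
    then show "x i \<in> carrier G" "h (x i) = y i"
      by (auto simp: x_def inv_into_into f_inv_into_f)
  qed
  have w: "fst ` set w \<subseteq> {1..n}" using assms(5) by (simp add: free_group_def)
  obtain N where N: "N \<in> S" "word_eval G x (engel_iter n w N) = \<one>\<^bsub>G\<^esub>"
    using van x by (metis Pi_I)
  have x_carrier: "x \<in> {1..n} \<rightarrow> carrier G" using x by auto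
  define T where "T = (\<lambda>g. word_eval G (x(1 := g)) w)"
  define U where "U = (\<lambda>g. word_eval H (y(1 := g)) w)"
  have T: "(T ^^ k) (x 1) \<in> carrier G \<and> h ((T ^^ k) (x 1)) = (U ^^ k) (y 1)" for k
  proof (induction k)
    case 0
    then show ?case using x assms(4) by simp
  next
    case (Suc k)
    let ?x = "x(1 := (T ^^ k) (x 1))"
    have c: "?x \<in> fst ` set w \<rightarrow> carrier G" using w x Suc by auto
    have "h (word_eval G ?x w) = word_eval H (h \<circ> ?x) w" using c by (rule hom_word_eval)
    also have "\<dots> = word_eval H (y(1 := h ((T ^^ k) (x 1)))) w"
      using w x by (intro word_eval_cong) auto
    also have "\<dots> = U ((U ^^ k) (y 1))" using Suc by (simp only: U_def)
    finally have "h (T ((T ^^ k) (x 1))) = U ((U ^^ k) (y 1))" by (simp only: T_def)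
    moreover have "T ((T ^^ k) (x 1)) \<in> carrier G"
      using G.word_eval_closed[OF c] by (simp only: T_def)
    ultimately show ?case by simp
  qed
  have "word_eval H y (engel_iter n w N) = h (word_eval G x (engel_iter n w N))"
    using T[of N] word_eval_engel_iter[OF assms(1,4,5) x_carrier]
      word_eval_engel_iter[OF assms(2,4,5) y] by (simp add: T_def U_def)
  with N show "\<exists>N\<in>S. word_eval H y (engel_iter n w N) = \<one>\<^bsub>H\<^esub>" by auto
qed

lemma iterated_identity_epi:
  assumes "group G" "group H" "h \<in> epi G H" "n \<ge> 1" "w \<in> carrier (free_group {1..n})"
    and "iterated_identity G n w"
  shows "iterated_identity H n w"
  using engel_iter_vanishing_epi[OF assms(1-5), of "{1..}"] assms(6)
  by (simp add: iterated_identity_def Bex_def)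

text \<open>If the slope is nonzero, the map is injective, and then every point lies on the cycle of 0,
  which is finite.\<close>

lemma affine_map_orbits_vanish:
  fixes m b :: "'a :: {idom, ring_char_0}"
  assumes orbits: "\<And>a. \<exists>N\<ge>1. ((\<lambda>a. m * a + b) ^^ N) a = 0"
  shows "m = 0 \<and> b = 0"
proof -
  let ?T = "\<lambda>a. m * a + b"
  have "m = 0"
  proof (rule ccontr)
    assume "m \<noteq> 0"
    then have inj: "inj (?T ^^ k)" for k by (intro inj_fn) (auto simp: inj_def)
    obtain P where P: "P \<ge> 1" "(?T ^^ P) 0 = 0" using orbits by blast
    have per: "(?T ^^ (k * P)) 0 = 0" for k
      using P by (induction k) (simp_all add: funpow_add)
    have "a \<in> (\<lambda>k. (?T ^^ k) 0) ` {..<P}" for a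
    proof -
      obtain N where N: "(?T ^^ N) a = 0" using orbits by blast
      \<comment> \<open>\<open>N * P\<close> is a multiple of the period that is at least
        \<open>N\<close>. Hence \<open>?T ^^ N\<close> sends both \<open>a\<close> and the point
        \<open>N * P - N\<close> steps after 0 to 0, and injectivity identifies the two.\<close>
      have "N \<le> N * P" using P by simp
      then have "(?T ^^ N) ((?T ^^ (N * P - N)) 0) = (?T ^^ (N * P)) 0"
        by (metis comp_apply funpow_add le_add_diff_inverse)
      then have "a = (?T ^^ (N * P - N)) 0"
        using inj[of N] N per[of N] by (simp add: inj_def)
      also have "\<dots> = (?T ^^ ((N * P - N) mod P)) 0"
        using P(2) by (rule funpow_mod_eq[symmetric])
      finally show ?thesis using P(1) by auto
    qed
    then have "UNIV \<subseteq> (\<lambda>k. (?T ^^ k) 0) ` {..<P}" by (intro subsetI)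
    then have "finite (UNIV :: 'a set)" by (rule finite_subset) simp
    then show False using infinite_UNIV_char_0 by blast
  qed
  \<comment> \<open>With slope 0 every step yields \<open>b\<close>, so returning to 0 after at
    least one step forces \<open>b = 0\<close>.\<close>
  moreover obtain N where "N \<ge> 1" "(?T ^^ N) 0 = 0" using orbits by blast
  ultimately show ?thesis by (cases N) auto
qed

text \<open>Every integer is central in the additive group, so \<open>word_eval_central\<close>
  gives an affine map with slope \<open>exponent_sum 1 w\<close>, whose constant term is the
  contribution of the other variables. Both vanish by \<open>affine_map_orbits_vanish\<close>,
  whatever those variables are.\<close>

lemma iterated_identity_integer_group:
  assumes "n \<ge> 1" "w \<in> carrier (free_group {1..n})" "iterated_identity integer_group n w"
  shows "exponent_sum 1 w = 0" "word_eval integer_group x w = 0"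
proof -
  have Z: "group integer_group" by simp
  have eq: "word_eval integer_group (x(1 := k)) w =
      exponent_sum 1 w * k + word_eval integer_group (x(1 := 0)) w" for k
    using group.word_eval_central[OF Z, of k x w 1] by (simp add: center_def add.commute)
  have "exponent_sum 1 w = 0 \<and> word_eval integer_group (x(1 := 0)) w = 0"
  proof (rule affine_map_orbits_vanish)
    fix k
    have "x(1 := k) \<in> {1..n} \<rightarrow> carrier integer_group" by simp
    then obtain N where N: "N \<ge> 1" "word_eval integer_group (x(1 := k)) (engel_iter n w N) = 0"
      using assms(3) unfolding iterated_identity_def one_integer_group by blast
    then have "((\<lambda>k. word_eval integer_group (x(1 := k)) w) ^^ N) k = 0"
      using word_eval_engel_iter[OF Z assms(1,2), of "x(1 := k)" N] by simp
    with N(1) show "\<exists>N\<ge>1. ((\<lambda>k. exponent_sum 1 w * k + word_eval integer_group (x(1 := 0)) w) ^^ N) k = 0"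
      unfolding eq[symmetric] by blast
  qed
  then show "exponent_sum 1 w = 0" "word_eval integer_group x w = 0"
    using eq[of "x 1"] by auto
qed

section \<open>The wreath product\<close>

lemma carrier_wreath_Z_Z: "carrier wreath_Z_Z = {f. finite {i. f i \<noteq> 0}} \<times> UNIV"
  by (simp add: wreath_Z_Z_def semidirect_product_def carrier_sum_group_Z)

lemma mult_wreath_Z_Z:
  "(f, h) \<otimes>\<^bsub>wreath_Z_Z\<^esub> (g, k) = (\<lambda>i. f i + shift h g i, h + k)"
  by (simp add: wreath_Z_Z_def semidirect_product_def restrict_def)

lemma one_wreath_Z_Z: "\<one>\<^bsub>wreath_Z_Z\<^esub> = (\<lambda>i. 0, 0)"
  by (simp add: wreath_Z_Z_def semidirect_product_def one_sum_group_Z del: one_sum_group)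

lemma snd_epi_wreath_Z_Z: "snd \<in> epi wreath_Z_Z integer_group"
proof -
  have "k \<in> snd ` carrier wreath_Z_Z" for k
    by (rule image_eqI[of _ _ "(\<lambda>_. 0, k)"]) (auto simp: carrier_wreath_Z_Z)
  then show ?thesis
    by (auto simp: epi_def hom_def mult_wreath_Z_Z)
qed

text \<open>Laurent polynomials over the integers: the power of t with exponent k is
  \<open>Poly_Mapping.single k 1\<close>, and the base group is the additive group of the ring.\<close>

definition wr :: "(int \<Rightarrow>\<^sub>0 int) \<Rightarrow> int \<Rightarrow> (int \<Rightarrow> int) \<times> int" where
  "wr a k = (Poly_Mapping.lookup a, k)"

lemma wr_eq_iff [simp]: "wr a h = wr b k \<longleftrightarrow> a = b \<and> h = k"
  by (simp add: wr_def)

lemma wr_closed [simp]: "wr a k \<in> carrier wreath_Z_Z"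
  by (simp add: wr_def carrier_wreath_Z_Z)

lemma wr_cases:
  assumes "g \<in> carrier wreath_Z_Z"
  obtains a where "g = wr a (snd g)"
proof (rule that[of "Abs_poly_mapping (fst g)"])
  have "finite {i. fst g i \<noteq> 0}" using assms by (auto simp: carrier_wreath_Z_Z)
  then show "g = wr (Abs_poly_mapping (fst g)) (snd g)" by (simp add: wr_def)
qed

lemma one_wr: "\<one>\<^bsub>wreath_Z_Z\<^esub> = wr 0 0"
  by (simp add: wr_def one_wreath_Z_Z fun_eq_iff)

text \<open>Convolution with a single monomial keeps one summand per coefficient. This turns the
  shift action into multiplication in the Laurent polynomial ring.\<close>

lemma shift_lookup:
  fixes a :: "int \<Rightarrow>\<^sub>0 int"
  shows "shift k (Poly_Mapping.lookup a) = Poly_Mapping.lookup (Poly_Mapping.single k 1 * a)"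
proof
  fix i
  have "Poly_Mapping.lookup (Poly_Mapping.single k 1 * a) i =
      Sum_any (\<lambda>l. Sum_any (\<lambda>q. Poly_Mapping.lookup a q when i = l + q) when k = l)"
    unfolding lookup_mult lookup_single by (intro Sum_any.cong) (simp add: when_def)
  also have "\<dots> = Sum_any (\<lambda>q. Poly_Mapping.lookup a q when q = i - k)"
    by (subst Sum_any_when_equal') (intro Sum_any.cong, auto simp: when_def)
  also have "\<dots> = Poly_Mapping.lookup a (i - k)" by simp
  finally show "shift k (Poly_Mapping.lookup a) i =
      Poly_Mapping.lookup (Poly_Mapping.single k 1 * a) i"
    by (simp add: shift_def)
qed

lemma mult_wr:
  "wr a h \<otimes>\<^bsub>wreath_Z_Z\<^esub> wr b k = wr (a + Poly_Mapping.single h 1 * b) (h + k)"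
  by (simp add: wr_def mult_wreath_Z_Z shift_lookup lookup_add[abs_def] fun_eq_iff)

lemma inv_wr: "inv\<^bsub>wreath_Z_Z\<^esub> (wr a h) = wr (- (Poly_Mapping.single (- h) 1 * a)) (- h)"
  by (rule group.inv_equality[OF group_wreath_Z_Z]) (simp_all add: mult_wr one_wr)

text \<open>A letter with variable \<open>i\<close> has second coordinate 0 and only adds
  \<open>a\<close> or \<open>- a\<close>; any other letter multiplies by a power of t and adds a
  constant. The slope \<open>m\<close> is the Fox derivative of \<open>w\<close> by variable
  \<open>i\<close>, with that variable sent to 1 and the others to powers of t.\<close>

lemma word_eval_wreath_Z_Z_affine:
  assumes "x \<in> fst ` set w \<rightarrow> carrier wreath_Z_Z"
  shows "\<exists>m b k. \<forall>a. word_eval wreath_Z_Z (x(i := wr a 0)) w = wr (m * a + b) k"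
  using assms
proof (induction w)
  case Nil
  have "\<forall>a. word_eval wreath_Z_Z (x(i := wr a 0)) [] = wr (0 * a + 0) 0"
    by (simp add: one_wr)
  then show ?case by blast
next
  case (Cons l w)
  then have "x \<in> fst ` set w \<rightarrow> carrier wreath_Z_Z" by auto
  from Cons.IH[OF this]
  obtain m b k where IH: "word_eval wreath_Z_Z (x(i := wr a 0)) w = wr (m * a + b) k" for a
    by blast
  show ?case
  proof (cases "fst l = i")
    case True
    define s :: "int \<Rightarrow>\<^sub>0 int" where "s = (if snd l then 1 else - 1)"
    have "word_eval wreath_Z_Z (x(i := wr a 0)) (l # w) = wr ((m + s) * a + b) k" for a
      using True IH by (simp add: mult_wr inv_wr algebra_simps s_def)
    then show ?thesis by blast
  next
    case False
    have "x (fst l) \<in> carrier wreath_Z_Z" using Cons.prems by auto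
    then obtain c h where c: "x (fst l) = wr c h" by (rule wr_cases)
    obtain c' h' where c': "(if snd l then x (fst l) else inv\<^bsub>wreath_Z_Z\<^esub> (x (fst l))) = wr c' h'"
    proof (cases "snd l")
      case True
      with c show ?thesis by (auto intro: that)
    next
      case False
      with c show ?thesis by (auto simp: inv_wr intro: that)
    qed
    have "word_eval wreath_Z_Z (x(i := wr a 0)) (l # w) = wr c' h' \<otimes>\<^bsub>wreath_Z_Z\<^esub> wr (m * a + b) k" for a
      unfolding word_eval_Cons c'[symmetric] IH using False by simp
    then have "word_eval wreath_Z_Z (x(i := wr a 0)) (l # w) =
        wr ((Poly_Mapping.single h' 1 * m) * a + (c' + Poly_Mapping.single h' 1 * b)) (h' + k)" for a
      by (simp add: mult_wr algebra_simps)
    then show ?thesis by blast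
  qed
qed

text \<open>The first claim is the integer case pulled back along \<open>snd\<close>. It shows that
  the affine map on the base takes values in the base, so the orbit argument applies again, now over
  the domain of Laurent polynomials.\<close>

lemma iterated_identity_wreath_Z_Z:
  assumes "n \<ge> 1" "w \<in> carrier (free_group {1..n})" "iterated_identity wreath_Z_Z n w"
    and "x \<in> {1..n} \<rightarrow> carrier wreath_Z_Z"
  shows "snd (word_eval wreath_Z_Z x w) = 0"
    and "word_eval wreath_Z_Z (x(1 := wr a 0)) w = \<one>\<^bsub>wreath_Z_Z\<^esub>"
proof -
  interpret W: group wreath_Z_Z by (rule group_wreath_Z_Z)
  interpret s: group_hom wreath_Z_Z integer_group snd
    using snd_epi_wreath_Z_Z group_wreath_Z_Z
    by (auto intro!: group_hom.intro group_hom_axioms.intro simp: epi_def)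
  have w: "fst ` set w \<subseteq> {1..n}" using assms(2) by (simp add: free_group_def)
  have Z: "iterated_identity integer_group n w"
    using iterated_identity_epi[OF group_wreath_Z_Z group_integer_group snd_epi_wreath_Z_Z assms(1-3)] .
  have snd_0: "snd (word_eval wreath_Z_Z y w) = 0"
    if "y \<in> {1..n} \<rightarrow> carrier wreath_Z_Z" for y
  proof -
    have "y \<in> fst ` set w \<rightarrow> carrier wreath_Z_Z" using w that by auto
    then have "snd (word_eval wreath_Z_Z y w) = word_eval integer_group (snd \<circ> y) w"
      by (rule s.hom_word_eval)
    then show ?thesis
      using iterated_identity_integer_group(2)[OF assms(1,2) Z] by simp
  qed
  show "snd (word_eval wreath_Z_Z x w) = 0" using assms(4) by (rule snd_0)
  have x: "x \<in> fst ` set w \<rightarrow> carrier wreath_Z_Z" using w assms(4) by auto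
  obtain m b k where eq: "\<And>a. word_eval wreath_Z_Z (x(1 := wr a 0)) w = wr (m * a + b) k"
    using word_eval_wreath_Z_Z_affine[OF x] by blast
  \<comment> \<open>With \<open>k = 0\<close> the map sends the base to itself, so its iterates
    there are those of the affine map on the ring.\<close>
  have "x(1 := wr 0 0) \<in> {1..n} \<rightarrow> carrier wreath_Z_Z" using assms(4) by auto
  then have k: "k = 0" using snd_0[of "x(1 := wr 0 0)"] eq[of 0] by (simp add: wr_def)
  have pow: "((\<lambda>g. word_eval wreath_Z_Z (x(1 := g)) w) ^^ N) (wr a 0) = wr (((\<lambda>a. m * a + b) ^^ N) a) 0" for N a
    by (induction N) (simp_all only: funpow.simps comp_apply id_apply eq k)
  have "m = 0 \<and> b = 0"
  proof (rule affine_map_orbits_vanish)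
    fix a
    have xa: "x(1 := wr a 0) \<in> {1..n} \<rightarrow> carrier wreath_Z_Z" using assms(4) by auto
    then obtain N where N: "N \<ge> 1"
        "word_eval wreath_Z_Z (x(1 := wr a 0)) (engel_iter n w N) = \<one>\<^bsub>wreath_Z_Z\<^esub>"
      using assms(3) unfolding iterated_identity_def by blast
    then have "((\<lambda>a. m * a + b) ^^ N) a = 0"
      using word_eval_engel_iter[OF group_wreath_Z_Z assms(1,2) xa, of N] pow[of N a]
      by (simp add: one_wr)
    with N(1) show "\<exists>N\<ge>1. ((\<lambda>a. m * a + b) ^^ N) a = 0" by blast
  qed
  then show "word_eval wreath_Z_Z (x(1 := wr a 0)) w = \<one>\<^bsub>wreath_Z_Z\<^esub>"
    using eq[of a] by (simp add: k one_wr)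
qed

section \<open>Central extensions of the wreath product\<close>

lemma engel_iter_3_central_extension:
  fixes G (structure)
  assumes "group G" "h \<in> epi G wreath_Z_Z" "kernel G wreath_Z_Z h = center G"
    and "n \<ge> 1" "w \<in> carrier (free_group {1..n})" "iterated_identity G n w"
    and x: "x \<in> {1..n} \<rightarrow> carrier G"
  shows "word_eval G x (engel_iter n w 3) = \<one>\<^bsub>G\<^esub>"
proof -
  interpret group G by fact
  interpret W: group wreath_Z_Z by (rule group_wreath_Z_Z)
  interpret h: group_hom G wreath_Z_Z h
    using assms(2) by unfold_locales (simp add: epi_def)
  have w: "fst ` set w \<subseteq> {1..n}" using assms(5) by (simp add: free_group_def)
  have W: "iterated_identity wreath_Z_Z n w"
    using iterated_identity_epi[OF assms(1) group_wreath_Z_Z assms(2,4-6)] .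
  have Z: "iterated_identity integer_group n w"
    using iterated_identity_epi[OF group_wreath_Z_Z group_integer_group snd_epi_wreath_Z_Z assms(4,5) W] .
  note W_id = iterated_identity_wreath_Z_Z[OF assms(4,5) W]
  define T where "T = (\<lambda>g. word_eval G (x(1 := g)) w)"
  have xg: "x(1 := g) \<in> fst ` set w \<rightarrow> carrier G" "x(1 := g) \<in> {1..n} \<rightarrow> carrier G"
    if "g \<in> carrier G" for g
  proof -
    show "x(1 := g) \<in> {1..n} \<rightarrow> carrier G" using that x by auto
    with w show "x(1 := g) \<in> fst ` set w \<rightarrow> carrier G" by blast
  qed
  have T_closed: "T g \<in> carrier G" if "g \<in> carrier G" for g
    using word_eval_closed[OF xg(1)[OF that]] by (simp only: T_def)
  have hx0: "h \<circ> x \<in> {1..n} \<rightarrow> carrier wreath_Z_Z"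
  proof
    fix i assume "i \<in> {1..n}"
    then have "x i \<in> carrier G" using x by auto
    then show "(h \<circ> x) i \<in> carrier wreath_Z_Z" by simp
  qed
  have hx: "(h \<circ> x)(1 := c) \<in> {1..n} \<rightarrow> carrier wreath_Z_Z" if "c \<in> carrier wreath_Z_Z" for c
    using that hx0 by auto
  have hT: "h (T g) = word_eval wreath_Z_Z ((h \<circ> x)(1 := h g)) w" if "g \<in> carrier G" for g
  proof -
    have "h (T g) = word_eval wreath_Z_Z (h \<circ> x(1 := g)) w"
      unfolding T_def using xg(1)[OF that] by (rule h.hom_word_eval)
    then show ?thesis by (simp only: fun_upd_comp)
  qed
  \<comment> \<open>Over the base the word is trivial in the wreath product, so its value in
    \<open>G\<close> lies in the kernel, which is the center.\<close>
  have T_base: "T g \<in> center G" if g: "g \<in> carrier G" and "h g = wr a 0" for g a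
  proof -
    have "h (T g) = \<one>\<^bsub>wreath_Z_Z\<^esub>"
      unfolding hT[OF g] that(2) by (rule W_id(2)[OF hx0])
    then show ?thesis using T_closed[OF g] assms(3) by (auto simp: kernel_def)
  qed
  \<comment> \<open>The factor \<open>c [^] exponent_sum 1 w\<close> is 1, because the integers are
    a quotient of the wreath product and force exponent sum 0.\<close>
  have T_central: "T c = T \<one>" if "c \<in> center G" for c
  proof -
    have "x \<in> fst ` set w \<rightarrow> carrier G" using w x by auto
    from word_eval_central[OF that this, of 1] show ?thesis
      using T_closed[of \<one>] iterated_identity_integer_group(1)[OF assms(4,5) Z]
      by (simp add: T_def)
  qed
  have T1: "T \<one> \<in> center G" by (rule T_base[of _ 0]) (simp_all add: one_wr[symmetric])
  have T_T: "T (T g) \<in> center G" if g: "g \<in> carrier G" for g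
  proof -
    have "h (T g) \<in> carrier wreath_Z_Z" using T_closed[OF g] by simp
    then obtain a where "h (T g) = wr a (snd (h (T g)))" by (rule wr_cases)
    moreover have "snd (h (T g)) = 0"
      unfolding hT[OF g] using g by (intro W_id(1) hx) simp
    ultimately show ?thesis using T_base[OF T_closed[OF g], of a] by simp
  qed
  \<comment> \<open>The orbit of 1 equals \<open>T \<one>\<close> from the first step on, since
    \<open>T \<one>\<close> is central; reaching 1 therefore means
    \<open>T \<one> = \<one>\<close>.\<close>
  obtain N where "N \<ge> 1" and N: "word_eval G (x(1 := \<one>)) (engel_iter n w N) = \<one>"
    using assms(6) xg(2)[of \<one>] unfolding iterated_identity_def by blast
  then obtain M where M: "N = Suc M" by (cases N) auto
  have "(T ^^ Suc M) \<one> = T \<one>" by (induction M) (simp_all add: T_central[OF T1])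
  moreover have "(T ^^ N) \<one> = \<one>"
    using N word_eval_engel_iter[OF assms(1,4,5) xg(2)[of \<one>], of N] by (simp add: T_def)
  ultimately have "T \<one> = \<one>" using M by simp
  moreover have "x 1 \<in> carrier G" using x assms(4) by auto
  ultimately have "T (T (T (x 1))) = \<one>" using T_central[OF T_T] by simp
  then show ?thesis
    using word_eval_engel_iter[OF assms(1,4,5) x, of 3] by (simp add: T_def numeral_3_eq_3)
qed

lemma one_le_identity_depth: "1 \<le> identity_depth G n w"
  unfolding identity_depth_def by (intro Inf_greatest) (auto simp: one_enat_def)

text \<open>The upper bound 3 is \<open>engel_iter_3_central_extension\<close>. The lower bound
  needs one non-trivial iterated identity: the wreath product is metabelian, so a commutator of two
  commutators is central in \<open>G\<close>, and bracketing it once more gives a law.\<close>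

lemma bounded_central_extension:
  fixes G (structure)
  assumes G: "group G" and "h \<in> epi G wreath_Z_Z" "kernel G wreath_Z_Z h = center G"
  shows "bounded_group G"
proof -
  interpret group G by fact
  interpret W: group wreath_Z_Z by (rule group_wreath_Z_Z)
  interpret Z: group integer_group by simp
  interpret h: group_hom G wreath_Z_Z h
    using assms(2) by unfold_locales (simp add: epi_def)
  interpret s: group_hom wreath_Z_Z integer_group snd
    using snd_epi_wreath_Z_Z by (auto intro!: group_hom.intro group_hom_axioms.intro simp: epi_def)
  \<comment> \<open>Using both the second variable and its inverse keeps all the concatenations
    freely reduced, so that \<open>w\<close> is visibly a non-trivial element of the free
    group.\<close>
  define a b where "a = word_commutator [(1::nat, True)] [(2, True)]"
    and "b = word_commutator [(1::nat, True)] [(2, False)]"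
  define u where "u = word_commutator a b"
  define w where "w = word_commutator u [(2, True)]"
  have fst: "fst ` set a = {1, 2}" "fst ` set b = {1, 2}" "fst ` set u = {1, 2}"
    by (auto simp: a_def b_def u_def word_commutator_def word_inv_def)
  have w_free: "w \<in> carrier (free_group {1..2})" "w \<noteq> \<one>\<^bsub>free_group {1..2}\<^esub>"
    by (auto simp: free_group_def reduced_def w_def u_def a_def b_def
        word_commutator_def word_inv_def letter_inv_def)
  \<comment> \<open>Commutators die in the abelian quotient, so \<open>a\<close> and
    \<open>b\<close> take values in the commutative base.\<close>
  have snd_comm: "snd (word_eval wreath_Z_Z y (word_commutator [c] [d])) = 0"
    if "y \<in> fst ` set (word_commutator [c] [d]) \<rightarrow> carrier wreath_Z_Z" for y and c d :: "nat \<times> bool"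
  proof -
    have "word_eval integer_group (snd \<circ> y) (word_commutator [c] [d]) = 0"
      using Z.word_eval_commutator[of "snd \<circ> y" "[c]" "[d]"] by simp
    with s.hom_word_eval[OF that] show ?thesis by simp
  qed
  have w_id: "word_eval G x w = \<one>" if x: "x \<in> {1..2} \<rightarrow> carrier G" for x
  proof -
    have x12: "x 1 \<in> carrier G" "x 2 \<in> carrier G" using x by auto
    have y: "h \<circ> x \<in> {1, 2} \<rightarrow> carrier wreath_Z_Z" using x12 by auto
    have xu: "x \<in> fst ` set u \<rightarrow> carrier G" unfolding fst using x12 by auto
    have "word_eval wreath_Z_Z (h \<circ> x) a \<in> carrier wreath_Z_Z"
      "word_eval wreath_Z_Z (h \<circ> x) b \<in> carrier wreath_Z_Z"
      by (intro W.word_eval_closed; use y fst in simp)+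
    then obtain f g where "word_eval wreath_Z_Z (h \<circ> x) a = wr f (snd (word_eval wreath_Z_Z (h \<circ> x) a))"
      "word_eval wreath_Z_Z (h \<circ> x) b = wr g (snd (word_eval wreath_Z_Z (h \<circ> x) b))"
      by (meson wr_cases)
    moreover have "snd (word_eval wreath_Z_Z (h \<circ> x) a) = 0"
      "snd (word_eval wreath_Z_Z (h \<circ> x) b) = 0"
      unfolding a_def b_def by (intro snd_comm; fold a_def b_def; use y fst in simp)+
    ultimately have "word_eval wreath_Z_Z (h \<circ> x) a = wr f 0" "word_eval wreath_Z_Z (h \<circ> x) b = wr g 0"
      by simp_all
    then have "word_eval wreath_Z_Z (h \<circ> x) u = \<one>\<^bsub>wreath_Z_Z\<^esub>"
      unfolding u_def using y fst by (intro W.word_eval_commutator) (simp_all add: mult_wr add.commute)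
    then have "word_eval G x u \<in> kernel G wreath_Z_Z h"
      using h.hom_word_eval[OF xu] word_eval_closed[OF xu] by (simp add: kernel_def)
    then have "word_eval G x u \<otimes> x 2 = x 2 \<otimes> word_eval G x u"
      using assms(3) x12 by (auto simp: center_def)
    then show ?thesis
      unfolding w_def using fst x12 by (intro word_eval_commutator) auto
  qed
  have "iterated_identity G 2 w"
    unfolding iterated_identity_def using w_id by (intro ballI exI[of _ 1]) simp
  then have "ereal_of_enat (identity_depth G 2 w) \<le> iterational_depth G"
    unfolding iterational_depth_def using w_free
    by (intro Sup_upper CollectI exI[of _ 2] exI[of _ w] conjI) simp_all
  moreover have "ereal_of_enat 1 \<le> ereal_of_enat (identity_depth G 2 w)"
    using one_le_identity_depth by (simp only: ereal_of_enat_le_iff)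
  ultimately have lower: "1 \<le> iterational_depth G"
    by (simp add: one_enat_def one_ereal_def)
  have "identity_depth G n w \<le> 3"
    if "n \<ge> 1" "w \<in> carrier (free_group {1..n})" "iterated_identity G n w" for n w
  proof -
    have "\<exists>d. 1 \<le> d \<and> d \<le> 3 \<and> word_eval G x (engel_iter n w d) = \<one>"
      if "x \<in> {1..n} \<rightarrow> carrier G" for x
      using engel_iter_3_central_extension[OF assms \<open>n \<ge> 1\<close> \<open>w \<in> _\<close> \<open>iterated_identity G n w\<close> that]
      by (intro exI[of _ 3]) simp
    then have "identity_depth G n w \<le> enat 3"
      unfolding identity_depth_def by (intro Inf_lower CollectI exI[of _ 3]) simp
    then show ?thesis by (simp add: numeral_eq_enat)
  qed
  then have "iterational_depth G \<le> ereal_of_enat 3"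
    unfolding iterational_depth_def by (intro Sup_least) (auto simp only: ereal_of_enat_le_iff mem_Collect_eq)
  also have "\<dots> < \<infinity>" by (simp add: numeral_eq_enat)
  finally show ?thesis using lower by (simp add: bounded_group_def)
qed

section \<open>The center\<close>

lemma word_eval_replicate:
  "group G \<Longrightarrow> x i \<in> carrier G \<Longrightarrow> word_eval G x (replicate k (i, True)) = x i [^]\<^bsub>G\<^esub> k"
  by (induction k) (simp_all add: monoid.nat_pow_Suc2 Group.group_def del: nat_pow_Suc)

lemma word_eval_engel_iter_power:
  fixes G (structure)
  assumes "group G" "x \<in> {1..1} \<rightarrow> carrier G"
  shows "word_eval G x (engel_iter 1 (replicate p (1, True)) N) = x 1 [^]\<^bsub>G\<^esub> (p ^ N)"
proof -
  interpret group G by fact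
  have x: "x 1 \<in> carrier G" using assms(2) by auto
  have "((\<lambda>g. word_eval G (x(1 := g)) (replicate p (1, True))) ^^ N) (x 1) = x 1 [^] (p ^ N)"
  proof (induction N)
    case (Suc N)
    have "word_eval G (x(1 := x 1 [^] (p ^ N))) (replicate p (1, True)) = (x 1 [^] (p ^ N)) [^] p"
      using word_eval_replicate[OF assms(1), of "x(1 := x 1 [^] (p ^ N))" 1 p] x by simp
    then show ?case
      using x Suc by (simp only: funpow.simps comp_apply nat_pow_pow power_Suc mult.commute)
  qed (use x in simp)
  moreover have "replicate p (1 :: nat, True) \<in> carrier (free_group {1..1})"
    by (auto simp: free_group_def reduced_def successively_conv_nth letter_inv_def)
  ultimately show ?thesis
    using word_eval_engel_iter[OF assms(1) order_refl _ assms(2)] by simp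
qed

text \<open>The power word with exponent \<open>p\<close> kills coordinate \<open>i\<close> after
  \<open>i\<close> iterations. Each element has finitely many nonzero coordinates, so its orbit
  reaches 1, but the required number of steps is unbounded over the group.\<close>

lemma not_bounded_iso_sum_cyclic:
  assumes p: "p > 1" and C: "group C"
    and iso: "C \<cong> sum_group {1::nat..} (\<lambda>i. integer_mod_group (p ^ i))" (is "_ \<cong> ?H")
  shows "\<not> bounded_group C"
proof -
  interpret group C by (rule C)
  interpret H: group ?H by simp
  obtain f where f: "f \<in> iso C ?H" using iso by (auto simp: is_iso_def)
  interpret f: group_hom C ?H f
    using f by unfold_locales (simp add: iso_def)
  have proj: "(\<lambda>y. y i) \<in> hom ?H (integer_mod_group (p ^ i))" if "i \<ge> 1" for i
    using that by (auto simp: hom_def carrier_sum_group)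
  have coord: "(y [^]\<^bsub>?H\<^esub> m) i = int m * y i mod int (p ^ i)"
    if "y \<in> carrier ?H" "i \<ge> 1" for y i and m :: nat
  proof -
    interpret P: group_hom ?H "integer_mod_group (p ^ i)" "\<lambda>y. y i"
      using proj[OF that(2)] by (intro group_hom.intro group_hom_axioms.intro) simp_all
    show ?thesis using P.hom_nat_pow[OF that(1), of m] by simp
  qed
  let ?w = "replicate p (1::nat, True)"
  have f_pow: "f (c [^]\<^bsub>C\<^esub> m) = f c [^]\<^bsub>?H\<^esub> m" if "c \<in> carrier C" for c and m :: nat
    using that by (rule f.hom_nat_pow)
  have "iterated_identity C 1 ?w"
    unfolding iterated_identity_def
  proof
    fix x assume x: "x \<in> {1..1::nat} \<rightarrow> carrier C"
    then have c: "x 1 \<in> carrier C" by auto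
    define y where "y = f (x 1)"
    have y: "y \<in> carrier ?H" unfolding y_def using c by (rule f.hom_closed)
    then have "finite {i \<in> {1..}. y i \<noteq> 0}" by (simp add: carrier_sum_group)
    \<comment> \<open>\<open>N\<close> bounds the indices of the nonzero coordinates;
      \<open>Suc N\<close> steps suffice and are at least one even if there are none.\<close>
    then obtain N where N: "\<forall>i \<in> {i \<in> {1..}. y i \<noteq> 0}. i \<le> N"
      using finite_nat_set_iff_bounded_le by auto
    have "(y [^]\<^bsub>?H\<^esub> (p ^ Suc N)) i = \<one>\<^bsub>?H\<^esub> i" for i
    proof (cases "i \<ge> 1")
      case True
      show ?thesis
      proof (cases "y i = 0")
        case i: True
        show ?thesis using True unfolding coord[OF y True] by (simp add: i)
      next
        case False
        then have "p ^ i dvd p ^ Suc N" using N True by (intro le_imp_power_dvd) auto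
        then have "int (p ^ i) dvd int (p ^ Suc N) * y i" by (intro dvd_mult2) (simp only: int_dvd_int_iff)
        then show ?thesis using True by (simp only: coord[OF y True]) simp
      qed
    next
      case False
      \<comment> \<open>Index 0 is outside the index set, where elements of the sum take the default
        value \<open>undefined\<close>.\<close>
      have "y [^]\<^bsub>?H\<^esub> (p ^ Suc N) \<in> carrier ?H" using y by (rule H.nat_pow_closed)
      then have "y [^]\<^bsub>?H\<^esub> (p ^ Suc N) \<in> extensional {1..}" by (auto simp: carrier_sum_group PiE_def)
      then show ?thesis using False by (simp add: extensional_def)
    qed
    then have "f (x 1 [^]\<^bsub>C\<^esub> (p ^ Suc N)) = f \<one>\<^bsub>C\<^esub>"
      using f_pow[OF c] by (simp add: y_def fun_eq_iff)
    then have "x 1 [^]\<^bsub>C\<^esub> (p ^ Suc N) = \<one>\<^bsub>C\<^esub>"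
    proof (rule inj_onD[rotated])
      show "inj_on f (carrier C)" using f by (simp add: iso_def bij_betw_def)
    qed (use c in simp_all)
    then show "\<exists>N\<ge>1. word_eval C x (engel_iter 1 ?w N) = \<one>\<^bsub>C\<^esub>"
      using word_eval_engel_iter_power[OF C x, of p "Suc N"] by (intro exI[of _ "Suc N"]) simp
  qed
  moreover have "identity_depth C 1 ?w = \<infinity>"
  proof -
    have False if D: "\<forall>x \<in> {1..1} \<rightarrow> carrier C.
        \<exists>d. 1 \<le> d \<and> d \<le> D \<and> word_eval C x (engel_iter 1 ?w d) = \<one>\<^bsub>C\<^esub>" for D
    proof -
      \<comment> \<open>A generator of the summand of order \<open>p ^ Suc D\<close>, which is not
        killed by \<open>p ^ d\<close> for any \<open>d \<le> D\<close>.\<close>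
      define y where "y = (\<lambda>i\<in>{1..}. if i = Suc D then 1 else 0 :: int)"
      have "{i \<in> {1..}. y i \<noteq> 0} \<subseteq> {Suc D}" by (auto simp: y_def)
      then have "finite {i \<in> {1..}. y i \<noteq> 0}" by (rule finite_subset) simp
      moreover have "1 < int p ^ Suc D" using p by (intro one_less_power) simp_all
      then have "y \<in> (\<Pi>\<^sub>E i\<in>{1..}. carrier (integer_mod_group (p ^ i)))"
        using p by (auto simp: y_def carrier_integer_mod_group)
      ultimately have y: "y \<in> carrier ?H" by (simp add: carrier_sum_group)
      then have "y \<in> f ` carrier C" using f by (simp add: iso_def bij_betw_def)
      then obtain c where c: "c \<in> carrier C" "f c = y" by blast
      then have x: "(\<lambda>_. c) \<in> {1..1} \<rightarrow> carrier C" by simp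
      then obtain d where d: "d \<le> D" "word_eval C (\<lambda>_. c) (engel_iter 1 ?w d) = \<one>\<^bsub>C\<^esub>"
        using D by blast
      then have "c [^]\<^bsub>C\<^esub> (p ^ d) = \<one>\<^bsub>C\<^esub>"
        using word_eval_engel_iter_power[OF C x] by simp
      then have "y [^]\<^bsub>?H\<^esub> (p ^ d) = \<one>\<^bsub>?H\<^esub>" using f_pow[OF c(1), of "p ^ d"] c(2) by simp
      then have "int (p ^ d) mod int (p ^ Suc D) = 0"
        using coord[OF y, of "Suc D" "p ^ d"] by (simp add: y_def)
      then have "p ^ Suc D dvd p ^ d" by (simp only: int_dvd_int_iff flip: dvd_eq_mod_eq_0)
      then have "Suc D \<le> d" using p by (rule power_dvd_imp_le)
      then show False using d(1) by simp
    qed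
    then have "{enat D |D. D \<ge> 1 \<and> (\<forall>x \<in> {1..1} \<rightarrow> carrier C.
            \<exists>d. 1 \<le> d \<and> d \<le> D \<and> word_eval C x (engel_iter 1 ?w d) = \<one>\<^bsub>C\<^esub>)} = {}"
      by blast
    then show ?thesis unfolding identity_depth_def by (simp only: Inf_empty top_enat_def)
  qed
  moreover have "?w \<in> carrier (free_group {1..1})" "?w \<noteq> \<one>\<^bsub>free_group {1..1}\<^esub>"
    using p by (auto simp: free_group_def reduced_def successively_conv_nth letter_inv_def)
  ultimately have "ereal_of_enat \<infinity> \<le> iterational_depth C"
    unfolding iterational_depth_def
    by (intro Sup_upper CollectI exI[of _ 1] exI[of _ ?w] conjI) simp_all
  then show ?thesis by (simp add: bounded_group_def)
qed

theorem mainTheorem8: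
  fixes G (structure) and p :: nat
  assumes "Factorial_Ring.prime p"
    and "group G" and "solvable G"
    and "G\<lparr>carrier := center G\<rparr> \<cong> sum_group {1::nat..} (\<lambda>i. integer_mod_group (p ^ i))"
    and "G Mod center G \<cong> wreath_Z_Z"
  shows "bounded_group G \<and> \<not> bounded_group (G\<lparr>carrier := center G\<rparr>)"
proof
  interpret group G by fact
  interpret N: normal "center G" G by (rule normal_center)
  obtain g where g: "g \<in> iso (G Mod center G) wreath_Z_Z"
    using assms(5) by (auto simp: is_iso_def)
  \<comment> \<open>The quotient map followed by the given isomorphism presents \<open>G\<close> as
    a central extension of the wreath product.\<close>
  define h where "h = g \<circ> (\<lambda>a. center G #> a)"
  have g_hom: "g \<in> hom (G Mod center G) wreath_Z_Z" using g by (simp add: iso_def)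
  have "h \<in> hom G wreath_Z_Z"
    unfolding h_def by (rule Group.hom_compose[OF N.r_coset_hom_Mod g_hom])
  moreover have "h ` carrier G = carrier wreath_Z_Z"
  proof -
    have "carrier (G Mod center G) = (\<lambda>a. center G #> a) ` carrier G"
      by (auto simp: FactGroup_def RCOSETS_def)
    then have "h ` carrier G = g ` carrier (G Mod center G)"
      unfolding h_def by (simp only: image_comp)
    then show ?thesis using g by (simp add: iso_def bij_betw_def)
  qed
  ultimately have "h \<in> epi G wreath_Z_Z" by (simp add: epi_def)
  moreover have "kernel G wreath_Z_Z h = center G"
  proof -
    interpret g: group_hom "G Mod center G" wreath_Z_Z g
      using g group_wreath_Z_Z N.factorgroup_is_group
      by (auto intro!: group_hom.intro group_hom_axioms.intro simp: iso_def)
    \<comment> \<open>Injectivity of \<open>g\<close> reduces the kernel of \<open>h\<close> to that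
      of the quotient map.\<close>
    have "h a = \<one>\<^bsub>wreath_Z_Z\<^esub> \<longleftrightarrow> center G #> a = center G" if "a \<in> carrier G" for a
    proof -
      have "center G #> a \<in> carrier (G Mod center G)"
        using that by (auto simp: FactGroup_def RCOSETS_def)
      moreover have "inj_on g (carrier (G Mod center G))" using g by (simp add: iso_def bij_betw_def)
      ultimately have "g (center G #> a) = \<one>\<^bsub>wreath_Z_Z\<^esub> \<longleftrightarrow> center G #> a = \<one>\<^bsub>G Mod center G\<^esub>"
        using g.hom_one g.G.one_closed by (metis inj_onD)
      then show ?thesis by (simp add: h_def)
    qed
    then have "kernel G wreath_Z_Z h = {a \<in> carrier G. center G #> a = center G}"
      by (auto simp: kernel_def)
    also have "\<dots> = center G"
      using N.rcos_const coset_join1[OF _ _ subgroup_center] N.mem_carrier by auto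
    finally show ?thesis .
  qed
  ultimately show "bounded_group G" by (rule bounded_central_extension[OF assms(2)])
  show "\<not> bounded_group (G\<lparr>carrier := center G\<rparr>)"
    using prime_gt_1_nat[OF assms(1)] subgroup_imp_group[OF subgroup_center] assms(4)
    by (rule not_bounded_iso_sum_cyclic)
qed

end
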